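(* Let $k\ge1$ and let $f_1,f_2,\ldots,f_k$ be transcendental entire functions, each of which has the annular domain property for some $m>1$. Suppose that there is a family of functions $(\psi_m)_{m>1}$ such that, for all $j\in\{1,2,\ldots,k\}$, $f_j$ is $\psi$-regular with regularity function $\psi_m$ for every $m>1$. Let $g=f_1\circ f_2\circ\cdots\circ f_k$. Then every component of the Fatou set $F(g)$ is bounded.
   Context: For an entire function $f$ put $M(r,f)=\max_{|z|=r}|f(z)|$ for $r>0$, and $B(0,r)=\{z\in\mathbb C:|z|<r\}$. The Fatou set $F(f)$ is the set of $z\in\mathbb C$ such that the iterates $(f^n)_{n\ge1}$ form a normal family in a neighbourhood of $z$. An entire function $f$ has the annular domain property for $m>1$ if there exists $R_0>0$ such that, for all $r\ge R_0$, there is a simply connected domain $G=G(r)$ with $B(0,r)\subset G\subset B(0,r^m)$ and $|f(z)|\ge M(r,f)$ for all $z\in\partial G$. A transcendental entire function $f$ is $\psi$-regular if for each $m>1$ there exist an increasing function $\psi_m$ (real-valued, defined for all sufficiently large $r$) and $R_m>0$ such that, for all $r\ge R_m$, $\psi_m(r)\ge r$ and $M(\psi_m(r),f)\ge(\psi_m(M(r,f)))^m$. For given $m$, $\psi_m$ is then called a regularity function for $f$. *)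

theory Defs
  imports "HOL-Complex_Analysis.Complex_Analysis"
begin

definition transcendental_entire :: "(complex \<Rightarrow> complex) \<Rightarrow> bool" where
  "transcendental_entire f \<longleftrightarrow>
     f holomorphic_on UNIV \<and> \<not> (\<exists>p :: complex poly. \<forall>z. f z = poly p z)"

text \<open>
  The supremum is a maximum for continuous \<open>f\<close> and \<open>r \<ge> 0\<close>, the circle being compact and
  nonempty. (\<open>Max\<close> is only meaningful for finite sets.)
\<close>

definition max_modulus :: "real \<Rightarrow> (complex \<Rightarrow> complex) \<Rightarrow> real" where
  "max_modulus r f = (SUP z\<in>sphere 0 r. norm (f z))"

text \<open>
  Normality is taken in the sense usual in complex dynamics, i.e. with values in the Riemann
  sphere: a subsequence may also tend locally uniformly to infinity. On a domain \<open>U\<close> the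
  spherical limit of a sequence of holomorphic functions is either holomorphic or identically
  infinity, so the two alternatives below are exhaustive; this is why the definition is only
  used for connected \<open>U\<close>.
\<close>

definition normal_family_on :: "complex set \<Rightarrow> (complex \<Rightarrow> complex) set \<Rightarrow> bool" where
  "normal_family_on U \<F> \<longleftrightarrow>
     (\<forall>h :: nat \<Rightarrow> complex \<Rightarrow> complex. range h \<subseteq> \<F> \<longrightarrow>
        (\<exists>\<sigma> :: nat \<Rightarrow> nat. strict_mono \<sigma> \<and>
           ((\<exists>l. l holomorphic_on U \<and>
                 (\<forall>K. compact K \<and> K \<subseteq> U \<longrightarrow> uniform_limit K (h \<circ> \<sigma>) l sequentially)) \<or>
            (\<forall>K. compact K \<and> K \<subseteq> U \<longrightarrow>
                 (\<forall>B. \<forall>\<^sub>F n in sequentially. \<forall>z\<in>K. norm (h (\<sigma> n) z) \<ge> B)))))"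

definition fatou_set :: "(complex \<Rightarrow> complex) \<Rightarrow> complex set" where
  "fatou_set f =
     {z. \<exists>U. open U \<and> connected U \<and> z \<in> U \<and> normal_family_on U {f ^^ n | n. n \<ge> 1}}"

definition annular_domain_property :: "real \<Rightarrow> (complex \<Rightarrow> complex) \<Rightarrow> bool" where
  "annular_domain_property m f \<longleftrightarrow>
     (\<exists>R0>0. \<forall>r\<ge>R0. \<exists>G. open G \<and> connected G \<and> simply_connected G \<and>
        ball 0 r \<subseteq> G \<and> G \<subseteq> ball 0 (r powr m) \<and>
        (\<forall>z\<in>frontier G. norm (f z) \<ge> max_modulus r f))"

text \<open>
  A function defined for all sufficiently large \<open>r\<close> is modelled by a total function of which
  only the values on some ray \<open>{D..}\<close> matter; the points \<open>r\<close> and \<open>max_modulus r f\<close> at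
  which it is evaluated must lie in that ray. Increasing is meant in the weak sense.
\<close>

definition regularity_function ::
    "(complex \<Rightarrow> complex) \<Rightarrow> real \<Rightarrow> (real \<Rightarrow> real) \<Rightarrow> bool" where
  "regularity_function f m \<psi> \<longleftrightarrow>
     (\<exists>D R. mono_on {D..} \<psi> \<and> R > 0 \<and>
        (\<forall>r\<ge>R. r \<ge> D \<and> max_modulus r f \<ge> D \<and> \<psi> r \<ge> r \<and>
           max_modulus (\<psi> r) f \<ge> \<psi> (max_modulus r f) powr m))"

definition psi_regular_with ::
    "(complex \<Rightarrow> complex) \<Rightarrow> (real \<Rightarrow> real \<Rightarrow> real) \<Rightarrow> bool" where
  "psi_regular_with f \<psi> \<longleftrightarrow>
     transcendental_entire f \<and> (\<forall>m>1. regularity_function f m (\<psi> m))"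

end

theory Submission
  imports Defs
begin

text \<open>
  Suppose a Fatou component of \<open>g\<close> is unbounded and join in it a point \<open>a\<close> with \<open>|a| \<le> r\<close> to a
  point \<open>b\<close> with \<open>|b| \<ge> \<psi>(r)\<^sup>c\<close> by a compact curve. The curve crosses the boundary of one of the
  domains \<open>G\<close>, so annular domain property, convexity of \<open>log M\<close> and regularity together give
  that its image under each \<open>f\<^sub>j\<close> has the same property with \<open>r\<close> replaced by \<open>M(r, f\<^sub>j)\<close> and \<open>c\<close> by
  \<open>2c\<close>. Hence on this fixed curve the iterates \<open>g\<^sup>n\<close> take arbitrarily large values, and the ratios
  of values of \<open>log |g\<^sup>n|\<close> are unbounded in \<open>n\<close>. But by normality a subsequence then tends to
  infinity locally uniformly on the component, where \<open>log |g\<^sup>n|\<close> is eventually positive and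
  harmonic, and Harnack's inequality bounds these ratios.
\<close>

section \<open>The maximum modulus of an entire function\<close>

lemma max_modulus_upper:
  assumes "continuous_on UNIV f" and "norm z = r"
  shows "norm (f z) \<le> max_modulus r f"
proof -
  have "compact ((\<lambda>z. norm (f z)) ` sphere 0 r)"
    by (intro compact_continuous_image continuous_on_norm continuous_on_subset[OF assms(1)]) auto
  then have "bdd_above ((\<lambda>z. norm (f z)) ` sphere 0 r)"
    by (intro bounded_imp_bdd_above compact_imp_bounded)
  then show ?thesis
    unfolding max_modulus_def by (rule cSUP_upper2[of _ _ z]) (use assms(2) in auto)
qed

lemma max_modulus_attained:
  assumes "continuous_on UNIV f" and "r \<ge> 0"
  obtains z where "norm z = r" "norm (f z) = max_modulus r f"
proof -
  have "compact (sphere (0::complex) r)" "sphere (0::complex) r \<noteq> {}"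
    using assms(2) by auto
  moreover have "continuous_on (sphere 0 r) (\<lambda>z. norm (f z))"
    by (intro continuous_on_norm continuous_on_subset[OF assms(1)]) auto
  ultimately obtain z where z: "z \<in> sphere 0 r" "\<forall>y\<in>sphere 0 r. norm (f y) \<le> norm (f z)"
    using continuous_attains_sup by blast
  have "max_modulus r f = norm (f z)"
    unfolding max_modulus_def by (rule cSup_eq_maximum) (use z in auto)
  with z that show ?thesis by auto
qed

lemma max_modulus_upper_cball:
  assumes "f holomorphic_on UNIV" and "norm z \<le> r"
  shows "norm (f z) \<le> max_modulus r f"
proof (rule maximum_modulus_frontier[of f "cball 0 r"])
  show "continuous_on (closure (cball 0 r)) f"
    by (rule holomorphic_on_imp_continuous_on[OF holomorphic_on_subset[OF assms(1)]]) auto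
  show "norm (f y) \<le> max_modulus r f" if "y \<in> frontier (cball 0 r)" for y
    using that frontier_cball[of "0::complex" r]
    by (intro max_modulus_upper holomorphic_on_imp_continuous_on[OF assms(1)]) auto
qed (use assms holomorphic_on_subset in auto)

text \<open>If \<open>M(r, f) < r\<close> held for arbitrarily large \<open>r\<close>, Cauchy's
  estimates on these circles would kill every Taylor coefficient of order at least \<open>2\<close>,
  and \<open>f\<close> would be an affine polynomial.\<close>

lemma transcendental_entire_max_modulus_ge:
  assumes "transcendental_entire f"
  shows "\<exists>T. \<forall>r\<ge>T. r \<le> max_modulus r f"
proof (rule ccontr)
  assume neg: "\<nexists>T. \<forall>r\<ge>T. r \<le> max_modulus r f"
  have holf: "f holomorphic_on UNIV" using assms by (simp add: transcendental_entire_def)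
  have contf: "continuous_on UNIV f" by (rule holomorphic_on_imp_continuous_on[OF holf])
  have deriv0: "(deriv ^^ n) f 0 = 0" if n: "n \<ge> 2" for n
  proof (rule ccontr)
    assume ne: "(deriv ^^ n) f 0 \<noteq> 0"
    define D where "D = norm ((deriv ^^ n) f 0)"
    have D: "D > 0" using ne by (simp add: D_def)
    \<comment> \<open>For \<open>n \<ge> 2\<close> Cauchy's estimate yields
      \<open>D \<le> fact n / r\<close>; the radius is taken at least \<open>2 * fact n / D\<close>
      to contradict this.\<close>
    obtain r where r: "r \<ge> max 1 (2 * fact n / D)" "max_modulus r f < r"
      using neg by (meson not_less)
    have r1: "r \<ge> 1" "r \<ge> 2 * fact n / D" using r by auto
    have "D \<le> fact n * r / r ^ n"
      unfolding D_def
    proof (rule Cauchy_inequality)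
      show "f holomorphic_on ball 0 r" using holf holomorphic_on_subset by blast
      show "continuous_on (cball 0 r) f" using contf continuous_on_subset by blast
      show "0 < r" using r1 by simp
      show "norm (f x) \<le> r" if "norm (0 - x) = r" for x
        using max_modulus_upper[OF contf, of x r] that r(2) by simp
    qed
    also have "\<dots> \<le> fact n * r / r ^ 2"
      using r1 n by (intro divide_left_mono power_increasing mult_nonneg_nonneg mult_pos_pos) auto
    also have "\<dots> = fact n / r"
      using r1 by (simp add: power2_eq_square)
    finally have "D * r \<le> fact n" using r1 by (simp add: field_simps)
    moreover have "2 * fact n \<le> D * r" using r1(2) D by (simp add: field_simps)
    ultimately show False using fact_gt_zero[of n, where 'a=real] by linarith
  qed
  have "f z = poly [:f 0, deriv f 0:] z" for z
  proof -
    have "(\<lambda>n. (deriv ^^ n) f 0 / fact n * (z - 0) ^ n) sums f z"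
      by (rule holomorphic_power_series[of _ _ "norm z + 1"])
         (use holf holomorphic_on_subset in auto)
    moreover have "(\<lambda>n. (deriv ^^ n) f 0 / fact n * (z - 0) ^ n) sums
        (\<Sum>n<2. (deriv ^^ n) f 0 / fact n * (z - 0) ^ n)"
      by (rule sums_finite) (use deriv0 in auto)
    ultimately have "f z = (\<Sum>n<2. (deriv ^^ n) f 0 / fact n * (z - 0) ^ n)"
      by (rule sums_unique2)
    then show ?thesis by (simp add: numeral_2_eq_2 algebra_simps)
  qed
  then show False using assms unfolding transcendental_entire_def by blast
qed

text \<open>
  Hadamard's three circles theorem with inner radius \<open>1\<close>; halving the exponent absorbs the
  contribution of the inner circle.
\<close>

lemma max_modulus_powr_ge:
  assumes holf: "f holomorphic_on UNIV" and s: "s > 1" and d: "d \<ge> 1"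
    and M1: "max_modulus s f > 1" and M2: "max_modulus s f \<ge> (max_modulus 1 f)\<^sup>2"
  shows "max_modulus s f powr (d / 2) \<le> max_modulus (s powr d) f"
proof (rule ccontr)
  assume neg: "\<not> ?thesis"
  have contf: "continuous_on UNIV f" by (rule holomorphic_on_imp_continuous_on[OF holf])
  define t M M' B where "t = s powr d" and "M = max_modulus s f"
    and "M' = max_modulus t f" and "B = max_modulus 1 f"
  have ts: "s \<le> t" using powr_mono[of 1 d s] s d by (simp add: t_def)
  obtain z0 where z0: "norm z0 = s" "norm (f z0) = M"
    using max_modulus_attained[OF contf, of s] s M_def by auto
  have "M \<le> M'" using max_modulus_upper_cball[OF holf, of z0 t] z0 ts by (simp add: M'_def)
  then have M': "M' > 0" "M > 1" using M1 by (auto simp: M_def)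
  have lns: "ln s > 0" using s by simp
  have lnM: "ln M > 0" using M' by simp
  have lnt: "ln t = d * ln s" using s by (simp add: t_def ln_powr)
  have "M' < M powr (d / 2)" using neg by (simp add: M_def M'_def t_def)
  then have "ln M' < ln (M powr (d/2))" using M' by (subst ln_less_cancel_iff) auto
  then have "ln M' < d / 2 * ln M" using M' by (simp add: ln_powr)
  then have "ln M' / (d * ln s) < ln M / (2 * ln s)"
    using lns d by (simp add: field_simps)
  then have "max 0 (ln M' / (d * ln s)) < ln M / (2 * ln s)" using lnM lns by simp
  \<comment> \<open>The classical argument compares \<open>|f(z)|\<close> with a power
    \<open>|z|\<close> to the \<open>\<alpha>\<close>. A rational \<open>\<alpha> = p / q\<close>
    makes \<open>f z ^ q / z ^ p\<close> single-valued, hence holomorphic off \<open>0\<close>; the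
    \<open>max 0\<close> ensures that \<open>p\<close> is a natural number without a sign. The two
    bounds on \<open>\<alpha>\<close> become \<open>i1\<close> and \<open>i2\<close> and serve the
    outer and the inner circle.\<close>
  then obtain \<alpha> where \<alpha>: "\<alpha> \<in> \<rat>" "max 0 (ln M' / (d * ln s)) < \<alpha>" "\<alpha> < ln M / (2 * ln s)"
    using Rats_dense_in_real by blast
  obtain p q :: nat where pq: "q \<noteq> 0" "\<bar>\<alpha>\<bar> = real p / real q"
    using Rats_abs_nat_div_natE[OF \<alpha>(1)] by metis
  have \<alpha>_eq: "\<alpha> = real p / real q" using pq \<alpha>(2) by simp
  have q0: "real q > 0" using pq by simp
  have i1: "q * ln M' < p * (d * ln s)"
    using \<alpha>(2) q0 lns d unfolding \<alpha>_eq by (simp add: field_simps)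
  have i2: "p * ln s < q * ln M / 2"
    using \<alpha>(3) q0 lns unfolding \<alpha>_eq by (simp add: field_simps)
  have pow: "x ^ n = exp (real n * ln x)" if "x > 0" for x :: real and n
    using that by (simp add: exp_of_nat_mult)
  have val: "M ^ q / s ^ p = exp (q * ln M - p * ln s)"
    using M' s by (simp add: pow exp_diff)
  have inner: "B ^ q < M ^ q / s ^ p"
  proof -
    have B0: "B \<ge> 0" using max_modulus_upper[OF contf, of 1 1] norm_ge_zero
      by (metis B_def norm_one order_trans)
    have "B \<le> sqrt M" using M2 by (intro real_le_rsqrt) (simp add: M_def B_def)
    then have "B ^ q \<le> sqrt M ^ q" using B0 by (intro power_mono)
    also have "sqrt M ^ q = exp (q * ln M / 2)" using M' by (simp add: pow ln_sqrt)
    also have "\<dots> < exp (q * ln M - p * ln s)" using i2 by simp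
    finally show ?thesis by (simp add: val)
  qed
  \<comment> \<open>By \<open>i1\<close> the left side is below \<open>1\<close>, and by
    \<open>i2\<close> the right side is above \<open>1\<close>.\<close>
  have outer: "M' ^ q / t ^ p < M ^ q / s ^ p"
  proof -
    have "t > 0" using ts s by simp
    then have "M' ^ q / t ^ p = exp (q * ln M' - p * (d * ln s))"
      using M' by (simp add: pow exp_diff lnt)
    also have "\<dots> < exp (q * ln M - p * ln s)"
      using i1 i2 mult_pos_pos[OF q0 lnM] by (simp only: exp_less_cancel_iff)
    finally show ?thesis by (simp add: val)
  qed
  define A where "A = cball (0::complex) t - ball 0 1"
  have clA: "closed A" unfolding A_def by (intro closed_Diff) auto
  have nz: "z \<noteq> 0" if "z \<in> A" for z using that by (auto simp: A_def)
  have holF: "(\<lambda>z. f z ^ q / z ^ p) holomorphic_on A"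
    by (intro holomorphic_intros holomorphic_on_subset[OF holf]) (use nz in auto)
  \<comment> \<open>Maximum principle on the annulus between the radii \<open>1\<close> and
    \<open>t\<close>: its interior point \<open>z0\<close>, where \<open>|f|\<close> is maximal on
    the circle of radius \<open>s\<close>, would beat both boundary circles.\<close>
  have "norm (f z0 ^ q / z0 ^ p) \<le> max (B ^ q) (M' ^ q / t ^ p)"
  proof (rule maximum_modulus_frontier[of "\<lambda>z. f z ^ q / z ^ p" A _ z0])
    show "(\<lambda>z. f z ^ q / z ^ p) holomorphic_on interior A"
      by (rule holomorphic_on_subset[OF holF interior_subset])
    show "continuous_on (closure A) (\<lambda>z. f z ^ q / z ^ p)"
      using clA holF by (simp add: holomorphic_on_imp_continuous_on)
    show "bounded A" unfolding A_def by (intro bounded_diff) auto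
    show "z0 \<in> A" using z0 ts s by (auto simp: A_def)
    fix z assume z: "z \<in> frontier A"
    have "frontier A \<subseteq> frontier (cball 0 t) \<union> frontier (ball 0 1)"
      unfolding A_def Diff_eq using frontier_Int_subset[of "cball 0 t" "- ball (0::complex) 1"]
      by (auto simp: frontier_complement)
    with z have "norm z = t \<or> norm z = 1" by (auto simp: frontier_cball)
    then show "norm (f z ^ q / z ^ p) \<le> max (B ^ q) (M' ^ q / t ^ p)"
    proof
      assume "norm z = t"
      then have "norm (f z ^ q / z ^ p) \<le> M' ^ q / t ^ p"
        using max_modulus_upper[OF contf, of z t] ts s
        by (auto simp: norm_divide norm_power M'_def intro!: divide_right_mono power_mono)
      then show ?thesis by simp
    next
      assume "norm z = 1"
      then have "norm (f z ^ q / z ^ p) \<le> B ^ q"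
        using max_modulus_upper[OF contf, of z 1]
        by (auto simp: norm_divide norm_power B_def intro!: power_mono)
      then show ?thesis by simp
    qed
  qed
  also have "\<dots> < M ^ q / s ^ p" using inner outer by simp
  finally show False using z0 by (simp add: norm_divide norm_power)
qed

section \<open>Harnack's inequality on Fatou components\<close>

text \<open>
  Schwarz's lemma applied to \<open>(h - h x) / (h + cnj (h x))\<close>, where \<open>F = exp h\<close>.
\<close>

lemma log_modulus_Harnack:
  assumes holF: "F holomorphic_on ball x \<rho>" and gt1: "\<And>z. z \<in> ball x \<rho> \<Longrightarrow> norm (F z) > 1"
    and \<rho>: "\<rho> > 0" and y: "dist x y \<le> \<rho> / 3"
  shows "ln (norm (F y)) \<le> 2 * ln (norm (F x))"
proof -
  have "F z \<noteq> 0" if "z \<in> ball x \<rho>" for z using gt1[OF that] by auto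
  then obtain h where holh: "h holomorphic_on ball x \<rho>" and Fh: "\<And>z. z \<in> ball x \<rho> \<Longrightarrow> F z = exp (h z)"
    using contractible_imp_holomorphic_log[OF holF] by (metis convex_ball convex_imp_contractible)
  have Reh: "Re (h z) = ln (norm (F z))" if "z \<in> ball x \<rho>" for z
    using Fh[OF that] by simp
  have Rep: "Re (h z) > 0" if "z \<in> ball x \<rho>" for z
    using ln_gt_zero[OF gt1[OF that]] by (simp only: Reh[OF that])
  have sub: "x + of_real \<rho> * u \<in> ball x \<rho>" if "norm u < 1" for u :: complex
    using that \<rho> by (simp add: dist_norm norm_mult)
  have xin: "x \<in> ball x \<rho>" and yin: "y \<in> ball x \<rho>" using \<rho> y by auto
  define \<phi> where "\<phi> u = (h (x + of_real \<rho> * u) - h x) / (h (x + of_real \<rho> * u) + cnj (h x))" for u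
  have nz: "h z + cnj (h x) \<noteq> 0" if "z \<in> ball x \<rho>" for z
    using Rep[OF that] Rep[OF xin] by (auto simp: complex_eq_iff)
  have hol\<phi>: "\<phi> holomorphic_on ball 0 1"
  proof -
    have "h \<circ> (\<lambda>u. x + of_real \<rho> * u) holomorphic_on ball 0 1"
      by (rule holomorphic_on_compose_gen[OF _ holh]) (auto intro!: holomorphic_intros sub)
    then have "(\<lambda>u. h (x + of_real \<rho> * u)) holomorphic_on ball 0 1"
      by (simp add: o_def)
    then show ?thesis unfolding \<phi>_def
      by (intro holomorphic_intros) (use nz sub in auto)
  qed
  \<comment> \<open>The two squares differ by \<open>4 * Re v * Re w\<close>, so the Moebius map in
    \<open>\<phi>\<close> sends the right half-plane into the unit disc.\<close>
  have sq: "norm (v - w) ^ 2 = (Re v - Re w)\<^sup>2 + (Im v - Im w)\<^sup>2"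
    "norm (v + cnj w) ^ 2 = (Re v + Re w)\<^sup>2 + (Im v - Im w)\<^sup>2" for v w
    by (simp_all add: cmod_power2)
  have "norm (\<phi> ((y - x) / of_real \<rho>)) \<le> norm ((y - x) / of_real \<rho>)"
  proof (rule Schwarz_Lemma(1)[OF hol\<phi>])
    show "\<phi> 0 = 0" by (simp add: \<phi>_def)
    show "norm ((y - x) / of_real \<rho>) < 1"
      using y \<rho> by (simp add: norm_divide dist_norm norm_minus_commute)
    show "norm (\<phi> u) < 1" if "norm u < 1" for u
    proof -
      let ?v = "h (x + of_real \<rho> * u)"
      have "Re ?v * Re (h x) > 0" using Rep sub[OF that] xin by simp
      then have "norm (?v - h x) ^ 2 < norm (?v + cnj (h x)) ^ 2"
        unfolding sq by (simp add: power2_eq_square algebra_simps)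
      then have "norm (?v - h x) < norm (?v + cnj (h x))"
        by (rule power_less_imp_less_base) simp
      then show ?thesis using nz[OF sub[OF that]]
        by (simp add: \<phi>_def norm_divide)
    qed
  qed
  \<comment> \<open>With the bound \<open>1 / 3\<close> the imaginary parts can be discarded,
    leaving \<open>3 * (A - B) \<le> A + B\<close> for the real parts \<open>A\<close> of
    \<open>h y\<close> and \<open>B\<close> of \<open>h x\<close>, that is
    \<open>A \<le> 2 * B\<close>.\<close>
  also have "\<dots> \<le> 1 / 3"
    using y \<rho> by (simp add: norm_divide dist_norm norm_minus_commute field_simps)
  finally have "3 * norm (h y - h x) \<le> norm (h y + cnj (h x))"
    using \<rho> nz[OF yin] by (simp add: \<phi>_def norm_divide field_simps)
  then have "(3 * norm (h y - h x)) ^ 2 \<le> norm (h y + cnj (h x)) ^ 2"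
    by (intro power_mono) auto
  then have "9 * ((Re (h y) - Re (h x))\<^sup>2 + (Im (h y) - Im (h x))\<^sup>2)
      \<le> (Re (h y) + Re (h x))\<^sup>2 + (Im (h y) - Im (h x))\<^sup>2"
    by (simp only: power_mult_distrib sq) simp
  then have "(3 * (Re (h y) - Re (h x)))\<^sup>2 \<le> (Re (h y) + Re (h x))\<^sup>2"
    unfolding power_mult_distrib[of 3]
    by simp (use zero_le_power2[of "Im (h y) - Im (h x)"] in linarith)
  then have "3 * (Re (h y) - Re (h x)) \<le> Re (h y) + Re (h x)"
    by (rule power2_le_imp_le) (use Rep[OF xin] Rep[OF yin] in simp)
  then show ?thesis unfolding Reh[OF xin] Reh[OF yin] by simp
qed

section \<open>Normality, escape to infinity and chains of Harnack bounds\<close>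

lemma open_fatou_set: "open (fatou_set f)"
proof (subst open_subopen, intro ballI)
  fix x assume "x \<in> fatou_set f"
  then obtain U where U: "open U" "x \<in> U" and "connected U" "normal_family_on U {f ^^ n | n. n \<ge> 1}"
    unfolding fatou_set_def by blast
  then have "U \<subseteq> fatou_set f" unfolding fatou_set_def by blast
  with U show "\<exists>T. open T \<and> x \<in> T \<and> T \<subseteq> fatou_set f" by blast
qed

lemma normal_family_onE:
  assumes "normal_family_on U \<F>" and "range h \<subseteq> \<F>"
  obtains (convergent) \<sigma> l where "strict_mono (\<sigma> :: nat \<Rightarrow> nat)" "l holomorphic_on U"
      "\<And>K. compact K \<Longrightarrow> K \<subseteq> U \<Longrightarrow> uniform_limit K (\<lambda>n. h (\<sigma> n)) l sequentially"
  | (escaping) \<sigma> where "strict_mono (\<sigma> :: nat \<Rightarrow> nat)"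
      "\<And>K B. compact K \<Longrightarrow> K \<subseteq> U \<Longrightarrow> \<forall>\<^sub>F n in sequentially. \<forall>z\<in>K. norm (h (\<sigma> n) z) \<ge> B"
  using assms(1)[unfolded normal_family_on_def, THEN spec, THEN mp, OF assms(2)]
proof (elim exE conjE disjE)
  fix \<sigma> :: "nat \<Rightarrow> nat" and l
  assume "strict_mono \<sigma>" "l holomorphic_on U"
    "\<forall>K. compact K \<and> K \<subseteq> U \<longrightarrow> uniform_limit K (h \<circ> \<sigma>) l sequentially"
  then show thesis by (intro convergent[of \<sigma> l]) (simp_all add: o_def)
next
  fix \<sigma> :: "nat \<Rightarrow> nat"
  assume "strict_mono \<sigma>" "\<forall>K. compact K \<and> K \<subseteq> U \<longrightarrow>
    (\<forall>B. \<forall>\<^sub>F n in sequentially. \<forall>z\<in>K. norm (h (\<sigma> n) z) \<ge> B)"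
  then show thesis by (intro escaping[of \<sigma>]) simp_all
qed

text \<open>Otherwise some subsequence violates the bound on \<open>K\<close> at every index.
  Normality thins it out further: a finite limit contradicts the escape at \<open>p\<close>, and
  uniform escape contradicts the choice of the subsequence.\<close>

lemma normal_family_escape:
  assumes norm: "normal_family_on U \<F>" and h: "range h \<subseteq> \<F>"
    and p: "p \<in> U" and esc: "filterlim (\<lambda>n. norm (h n p)) at_top sequentially"
    and K: "compact K" "K \<subseteq> U"
  shows "\<forall>\<^sub>F n in sequentially. \<forall>z\<in>K. norm (h n z) \<ge> B"
proof (rule ccontr)
  assume "\<not> ?thesis"
  then obtain \<tau> :: "nat \<Rightarrow> nat" where \<tau>: "strict_mono \<tau>" "\<And>n. \<not> (\<forall>z\<in>K. norm (h (\<tau> n) z) \<ge> B)"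
    by (blast dest: not_eventually_sequentiallyD)
  have "range (h \<circ> \<tau>) \<subseteq> \<F>" using h by auto
  with norm show False
  proof (cases rule: normal_family_onE)
    case (convergent \<sigma> l)
    have "(\<lambda>n. h (\<tau> (\<sigma> n)) p) \<longlonglongrightarrow> l p" using convergent(3)[of "{p}"] p by simp
    then have "(\<lambda>n. norm (h (\<tau> (\<sigma> n)) p)) \<longlonglongrightarrow> norm (l p)" by (rule tendsto_norm)
    moreover have "strict_mono (\<tau> \<circ> \<sigma>)" by (intro strict_mono_o \<tau> convergent)
    then have "filterlim (\<lambda>n. norm (h (\<tau> (\<sigma> n)) p)) at_top sequentially"
      using filterlim_compose[OF esc filterlim_subseq] by fastforce
    ultimately show False
      using not_tendsto_and_filterlim_at_infinity[OF sequentially_bot]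
        filterlim_at_top_imp_at_infinity by blast
  next
    case (escaping \<sigma>)
    from escaping(2)[OF K, of B] have "\<forall>\<^sub>F n::nat in sequentially. False"
      by eventually_elim (use \<tau>(2) in simp)
    then show False by simp
  qed
qed

text \<open>Escape at \<open>p\<close> is uniform on a closed disc about \<open>p\<close>, where
  therefore eventually \<open>|h n| > 1\<close>, so that \<open>log_modulus_Harnack\<close> applies
  with either point as centre.\<close>

lemma normal_family_Harnack:
  assumes norm: "normal_family_on U \<F>" and h: "range h \<subseteq> \<F>" and U: "open U"
    and hol: "\<And>n. h n holomorphic_on UNIV"
    and p: "p \<in> U" and esc: "filterlim (\<lambda>n. norm (h n p)) at_top sequentially"
  obtains \<delta> where "\<delta> > 0" "\<forall>\<^sub>F n in sequentially. \<forall>x\<in>ball p \<delta>. 1 < norm (h n x) \<and>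
     ln (norm (h n x)) \<le> 2 * ln (norm (h n p)) \<and> ln (norm (h n p)) \<le> 2 * ln (norm (h n x))"
proof -
  obtain \<rho> where \<rho>: "\<rho> > 0" "cball p \<rho> \<subseteq> U" using U p open_contains_cball by blast
  have "\<forall>\<^sub>F n in sequentially. \<forall>z\<in>cball p \<rho>. norm (h n z) \<ge> 2"
    by (rule normal_family_escape[OF norm h p esc]) (use \<rho> in auto)
  \<comment> \<open>For \<open>x\<close> within \<open>\<rho>/4\<close> of \<open>p\<close>, the
    disc of radius \<open>3 * \<rho> / 4\<close> about \<open>x\<close> stays inside the one of
    radius \<open>\<rho>\<close> about \<open>p\<close>, and \<open>\<rho>/4\<close> is a third of
    its radius, as the Harnack bound centred at \<open>x\<close> demands.\<close>
  then have "\<forall>\<^sub>F n in sequentially. \<forall>x\<in>ball p (\<rho>/4). 1 < norm (h n x) \<and>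
     ln (norm (h n x)) \<le> 2 * ln (norm (h n p)) \<and> ln (norm (h n p)) \<le> 2 * ln (norm (h n x))"
  proof (eventually_elim, intro ballI)
    fix n x assume *: "\<forall>z\<in>cball p \<rho>. norm (h n z) \<ge> 2" and x: "x \<in> ball p (\<rho>/4)"
    have gt: "1 < norm (h n z)" if "z \<in> cball p \<rho>" for z using * that by force
    have 1: "1 < norm (h n x)" using gt[of x] x \<rho>(1) by auto
    have 2: "ln (norm (h n x)) \<le> 2 * ln (norm (h n p))"
      by (rule log_modulus_Harnack[of _ p \<rho>])
         (use x \<rho>(1) gt in \<open>auto intro: holomorphic_on_subset[OF hol]\<close>)
    have 3: "ln (norm (h n p)) \<le> 2 * ln (norm (h n x))"
    proof (rule log_modulus_Harnack[of _ x "3 * \<rho> / 4"])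
      show "1 < norm (h n z)" if "z \<in> ball x (3 * \<rho> / 4)" for z
        using gt[of z] that x dist_triangle[of p z x] by auto
    qed (use x \<rho>(1) in \<open>auto simp: dist_commute intro: holomorphic_on_subset[OF hol]\<close>)
    from 1 2 3 show "1 < norm (h n x) \<and>
     ln (norm (h n x)) \<le> 2 * ln (norm (h n p)) \<and> ln (norm (h n p)) \<le> 2 * ln (norm (h n x))"
      by blast
  qed
  with \<rho> that[of "\<rho>/4"] show thesis by auto
qed

text \<open>By \<open>normal_family_escape\<close>, whether a point escapes is locally constant on
  \<open>C\<close>, hence constant by connectedness.\<close>

lemma locally_normal_escape:
  assumes C: "connected C" and loc: "\<And>z. z \<in> C \<Longrightarrow> \<exists>U. open U \<and> z \<in> U \<and> normal_family_on U \<F>"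
    and h: "range h \<subseteq> \<F>" and p: "p \<in> C" and q: "q \<in> C"
    and esc: "filterlim (\<lambda>n. norm (h n p)) at_top sequentially"
  shows "filterlim (\<lambda>n. norm (h n q)) at_top sequentially"
proof -
  define E where "E x = filterlim (\<lambda>n. norm (h n x)) at_top sequentially" for x
  have "E p = E q"
  proof (rule connected_equivalence_relation[OF C p q, where R = "\<lambda>x y. E x = E y"])
    fix a assume "a \<in> C"
    then obtain U where U: "open U" "a \<in> U" "normal_family_on U \<F>" using loc by blast
    have E: "E y" if "E x" "x \<in> U" "y \<in> U" for x y
    proof -
      have "\<forall>\<^sub>F n in sequentially. B \<le> norm (h n y)" for B
        using normal_family_escape[OF U(3) h that(2), of "{y}" B] that by (auto simp: E_def)
      then show ?thesis by (simp add: E_def filterlim_at_top)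
    qed
    show "\<exists>T. openin (top_of_set C) T \<and> a \<in> T \<and> (\<forall>x\<in>T. E a = E x)"
      by (rule exI[of _ "C \<inter> U"]) (use U E \<open>a \<in> C\<close> in auto)
  qed auto
  with esc show ?thesis by (simp add: E_def)
qed

text \<open>Being comparable with a constant independent of \<open>n\<close> is an equivalence
  relation whose classes are relatively open, by the local bound with factor \<open>2\<close>; a
  connected set has only one class. The relation \<open>E\<close> is two-sided to make it symmetric,
  and constants multiply under transitivity.\<close>

lemma locally_normal_Harnack:
  assumes C: "connected C" and loc: "\<And>z. z \<in> C \<Longrightarrow> \<exists>U. open U \<and> z \<in> U \<and> normal_family_on U \<F>"
    and h: "range h \<subseteq> \<F>" and hol: "\<And>n. h n holomorphic_on UNIV"
    and esc: "\<And>z. z \<in> C \<Longrightarrow> filterlim (\<lambda>n. norm (h n z)) at_top sequentially"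
    and p: "p \<in> C" and q: "q \<in> C"
  shows "\<exists>K>0. \<forall>\<^sub>F n in sequentially. ln (norm (h n p)) \<le> K * ln (norm (h n q))"
proof -
  define L where "L n x = ln (norm (h n x))" for n x
  define E where "E x y \<longleftrightarrow> (\<exists>K>0. \<forall>\<^sub>F n in sequentially. L n x \<le> K * L n y \<and> L n y \<le> K * L n x)"
    for x y
  have "E p q"
  proof (rule connected_equivalence_relation[OF C p q, where R = E])
    show "E y x" if "E x y" for x y using that unfolding E_def by (simp add: conj_commute)
    show "E x z" if xy: "E x y" and yz: "E y z" for x y z
    proof -
      obtain K where K: "K > 0" "\<forall>\<^sub>F n in sequentially. L n x \<le> K * L n y \<and> L n y \<le> K * L n x"
        using xy unfolding E_def by blast
      obtain K' where K': "K' > 0" "\<forall>\<^sub>F n in sequentially. L n y \<le> K' * L n z \<and> L n z \<le> K' * L n y"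
        using yz unfolding E_def by blast
      from K(2) K'(2) have "\<forall>\<^sub>F n in sequentially. L n x \<le> (K * K') * L n z \<and> L n z \<le> (K * K') * L n x"
      proof eventually_elim
        case (elim n)
        have "K * L n y \<le> K * (K' * L n z)" "K' * L n y \<le> K' * (K * L n x)"
          using elim K(1) K'(1) by (auto intro!: mult_left_mono)
        with elim show ?case by (simp add: mult_ac)
      qed
      then show ?thesis using K(1) K'(1) unfolding E_def by (intro exI[of _ "K * K'"]) auto
    qed
    fix a assume a: "a \<in> C"
    then obtain U where U: "open U" "a \<in> U" "normal_family_on U \<F>" using loc by blast
    obtain \<delta> where \<delta>: "\<delta> > 0" "\<forall>\<^sub>F n in sequentially. \<forall>x\<in>ball a \<delta>. 1 < norm (h n x) \<and>
       L n x \<le> 2 * L n a \<and> L n a \<le> 2 * L n x"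
      by (rule normal_family_Harnack[OF U(3) h U(1) hol U(2) esc[OF a], folded L_def])
    have "E a x" if "x \<in> ball a \<delta>" for x
      unfolding E_def by (rule exI[of _ 2]) (use \<delta>(2) that in \<open>auto elim!: eventually_mono\<close>)
    then show "\<exists>T. openin (top_of_set C) T \<and> a \<in> T \<and> (\<forall>x\<in>T. E a x)"
      by (intro exI[of _ "C \<inter> ball a \<delta>"]) (use a \<delta>(1) in auto)
  qed
  then obtain K where "K > 0" "\<forall>\<^sub>F n in sequentially. L n p \<le> K * L n q \<and> L n q \<le> K * L n p"
    unfolding E_def by blast
  then show ?thesis unfolding L_def by (intro exI[of _ K]) (auto elim: eventually_mono)
qed

text \<open>The points \<open>z n\<close> and \<open>w n\<close> vary with \<open>n\<close>, whereas
  the Harnack chain compares fixed points. Compactness of \<open>S\<close> supplies limits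
  \<open>z0\<close> and \<open>w0\<close> along a subsequence, and local Harnack bounds at these
  limits absorb the movement.\<close>

lemma fatou_component_distortion:
  assumes C: "C \<in> components (fatou_set g)" and holg: "g holomorphic_on UNIV"
    and S: "compact S" "S \<subseteq> C" and zS: "\<And>n. z n \<in> S" and wS: "\<And>n. w n \<in> S"
    and esc: "filterlim (\<lambda>n. norm ((g ^^ n) (w n))) at_top sequentially"
  obtains K \<sigma> where "K > 0" "strict_mono (\<sigma> :: nat \<Rightarrow> nat)"
    "\<forall>\<^sub>F n in sequentially. 1 < norm ((g ^^ \<sigma> n) (z (\<sigma> n))) \<and>
       ln (norm ((g ^^ \<sigma> n) (w (\<sigma> n)))) \<le> K * ln (norm ((g ^^ \<sigma> n) (z (\<sigma> n))))"
proof -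
  define \<F> where "\<F> = {g ^^ n | n. n \<ge> 1}"
  have conn: "connected C" by (rule in_components_connected[OF C])
  have loc: "\<exists>U. open U \<and> x \<in> U \<and> normal_family_on U \<F>" if "x \<in> C" for x
    using in_components_subset[OF C] that unfolding fatou_set_def \<F>_def by blast
  have hol: "(g ^^ n) holomorphic_on UNIV" for n
  proof (induction n)
    case (Suc n)
    then show ?case using holomorphic_on_compose_gen[OF Suc holg] by (simp add: o_def)
  qed (simp add: id_def)
  obtain w0 r where w0: "w0 \<in> S" "strict_mono (r :: nat \<Rightarrow> nat)" "(w \<circ> r) \<longlonglongrightarrow> w0"
    using S(1) wS unfolding compact_eq_seq_compact_metric by (metis seq_compactE)
  obtain z0 r' where z0: "z0 \<in> S" "strict_mono (r' :: nat \<Rightarrow> nat)" "(z \<circ> r \<circ> r') \<longlonglongrightarrow> z0"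
    using S(1) zS unfolding compact_eq_seq_compact_metric
    by (metis (no_types, lifting) comp_apply seq_compactE)
  \<comment> \<open>The shift by \<open>Suc\<close> makes all indices at least \<open>1\<close>,
    since the identity does not count among the iterates in \<open>\<F>\<close>.\<close>
  define \<sigma>1 where "\<sigma>1 = r \<circ> r' \<circ> Suc"
  have \<sigma>1: "strict_mono \<sigma>1" unfolding \<sigma>1_def
    by (intro strict_mono_o w0 z0) (simp add: strict_mono_Suc_iff)
  have \<sigma>1_ge: "\<sigma>1 n \<ge> 1" for n
    using strict_mono_less[OF strict_mono_o[OF w0(2) z0(2)], of 0 "Suc n"] by (simp add: \<sigma>1_def)
  obtain U where U: "open U" "w0 \<in> U" "normal_family_on U \<F>" using loc w0 S by blast
  have "range (\<lambda>n. g ^^ \<sigma>1 n) \<subseteq> \<F>" using \<sigma>1_ge unfolding \<F>_def by blast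
  \<comment> \<open>Both outcomes of normality are kept in one disjunction, so that the final
    subsequence \<open>\<sigma>\<close> can be fixed before the finite limit is excluded.\<close>
  with U(3) obtain \<rho> :: "nat \<Rightarrow> nat" where \<rho>: "strict_mono \<rho>"
    and alt: "(\<exists>l. l holomorphic_on U \<and> (\<forall>K. compact K \<longrightarrow> K \<subseteq> U \<longrightarrow>
           uniform_limit K (\<lambda>n. g ^^ \<sigma>1 (\<rho> n)) l sequentially)) \<or>
         (\<forall>K B. compact K \<longrightarrow> K \<subseteq> U \<longrightarrow>
           (\<forall>\<^sub>F n in sequentially. \<forall>z\<in>K. norm ((g ^^ \<sigma>1 (\<rho> n)) z) \<ge> B))"
    by (cases rule: normal_family_onE) blast+
  define \<sigma> where "\<sigma> = \<sigma>1 \<circ> \<rho>"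
  define h where "h n = g ^^ \<sigma> n" for n
  have \<sigma>: "strict_mono \<sigma>" unfolding \<sigma>_def by (intro strict_mono_o \<sigma>1 \<rho>)
  have h: "range h \<subseteq> \<F>" using \<sigma>1_ge unfolding h_def \<sigma>_def \<F>_def by fastforce
  have holh: "h n holomorphic_on UNIV" for n unfolding h_def by (rule hol)
  have limw: "(\<lambda>n. w (\<sigma> n)) \<longlonglongrightarrow> w0"
    using LIMSEQ_subseq_LIMSEQ[OF w0(3), of "r' \<circ> Suc \<circ> \<rho>"] z0(2) \<rho>
    by (auto simp: \<sigma>_def \<sigma>1_def o_def strict_mono_def)
  have limz: "(\<lambda>n. z (\<sigma> n)) \<longlonglongrightarrow> z0"
    using LIMSEQ_subseq_LIMSEQ[OF z0(3), of "Suc \<circ> \<rho>"] \<rho>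
    by (auto simp: \<sigma>_def \<sigma>1_def o_def strict_mono_def)
  have escw: "filterlim (\<lambda>n. norm (h n (w (\<sigma> n)))) at_top sequentially"
    using filterlim_compose[OF esc filterlim_subseq[OF \<sigma>]] by (simp add: h_def)
  \<comment> \<open>Escape is known only at the moving points \<open>w (\<sigma> n)\<close>. As
    these tend to \<open>w0\<close>, a finite limit function, bounded on a closed disc about
    \<open>w0\<close>, would keep the values there bounded.\<close>
  have esc0: "filterlim (\<lambda>n. norm (h n w0)) at_top sequentially"
    using alt
  proof
    assume "\<exists>l. l holomorphic_on U \<and> (\<forall>K. compact K \<longrightarrow> K \<subseteq> U \<longrightarrow>
           uniform_limit K (\<lambda>n. g ^^ \<sigma>1 (\<rho> n)) l sequentially)"
    then obtain l where l: "l holomorphic_on U"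
      "\<And>K. compact K \<Longrightarrow> K \<subseteq> U \<Longrightarrow> uniform_limit K h l sequentially"
      unfolding h_def \<sigma>_def o_apply by auto
    obtain e where e: "e > 0" "cball w0 e \<subseteq> U" using U open_contains_cball by blast
    have ul: "uniform_limit (cball w0 e) h l sequentially" using l(2) e by auto
    have "compact (l ` cball w0 e)"
      by (intro compact_continuous_image holomorphic_on_imp_continuous_on
            holomorphic_on_subset[OF l(1)] e) auto
    then obtain B where B: "\<And>x. x \<in> cball w0 e \<Longrightarrow> norm (l x) \<le> B"
      using compact_imp_bounded bounded_iff by (metis image_eqI)
    have "\<forall>\<^sub>F n in sequentially. \<forall>x\<in>cball w0 e. dist (h n x) (l x) < 1"
      using ul unfolding uniform_limit_iff by auto
    moreover have "\<forall>\<^sub>F n in sequentially. w (\<sigma> n) \<in> ball w0 e"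
      using limw e by (auto simp: tendsto_iff dist_commute)
    moreover have "\<forall>\<^sub>F n in sequentially. B + 1 \<le> norm (h n (w (\<sigma> n)))"
      using escw by (simp add: filterlim_at_top)
    ultimately have "\<forall>\<^sub>F n::nat in sequentially. False"
    proof eventually_elim
      case (elim n)
      then have "dist (h n (w (\<sigma> n))) (l (w (\<sigma> n))) < 1" "norm (l (w (\<sigma> n))) \<le> B"
        using B by auto
      then show ?case
        using elim norm_triangle_ineq2[of "h n (w (\<sigma> n))" "l (w (\<sigma> n))"] by (simp add: dist_norm)
    qed
    then show ?thesis by simp
  next
    assume *: "\<forall>K B. compact K \<longrightarrow> K \<subseteq> U \<longrightarrow>
           (\<forall>\<^sub>F n in sequentially. \<forall>z\<in>K. norm ((g ^^ \<sigma>1 (\<rho> n)) z) \<ge> B)"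
    show ?thesis
      unfolding filterlim_at_top using spec[OF *, of "{w0}"] U by (simp add: h_def \<sigma>_def)
  qed
  have w0C: "w0 \<in> C" and z0C: "z0 \<in> C" using w0 z0 S by auto
  have escC: "filterlim (\<lambda>n. norm (h n x)) at_top sequentially" if "x \<in> C" for x
    by (rule locally_normal_escape[OF conn loc h w0C that esc0])
  obtain K where K: "K > 0" "\<forall>\<^sub>F n in sequentially. ln (norm (h n w0)) \<le> K * ln (norm (h n z0))"
    using locally_normal_Harnack[OF conn loc h holh escC w0C z0C] by blast
  obtain \<delta> where \<delta>: "\<delta> > 0" "\<forall>\<^sub>F n in sequentially. \<forall>x\<in>ball w0 \<delta>. 1 < norm (h n x) \<and>
     ln (norm (h n x)) \<le> 2 * ln (norm (h n w0)) \<and> ln (norm (h n w0)) \<le> 2 * ln (norm (h n x))"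
    by (rule normal_family_Harnack[OF U(3) h U(1) holh U(2) esc0])
  obtain V where V: "open V" "z0 \<in> V" "normal_family_on V \<F>" using loc z0C by blast
  obtain \<epsilon> where \<epsilon>: "\<epsilon> > 0" "\<forall>\<^sub>F n in sequentially. \<forall>x\<in>ball z0 \<epsilon>. 1 < norm (h n x) \<and>
     ln (norm (h n x)) \<le> 2 * ln (norm (h n z0)) \<and> ln (norm (h n z0)) \<le> 2 * ln (norm (h n x))"
    by (rule normal_family_Harnack[OF V(3) h V(1) holh V(2) escC[OF z0C]])
  have "\<forall>\<^sub>F n in sequentially. w (\<sigma> n) \<in> ball w0 \<delta>" "\<forall>\<^sub>F n in sequentially. z (\<sigma> n) \<in> ball z0 \<epsilon>"
    using limw limz \<delta>(1) \<epsilon>(1) by (auto simp: tendsto_iff dist_commute)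
  \<comment> \<open>The path is \<open>w (\<sigma> n)\<close> to \<open>w0\<close> to
    \<open>z0\<close> to \<open>z (\<sigma> n)\<close>, with factors \<open>2\<close>,
    \<open>K\<close> and \<open>2\<close>.\<close>
  with K(2) \<delta>(2) \<epsilon>(2)
  have "\<forall>\<^sub>F n in sequentially. 1 < norm (h n (z (\<sigma> n))) \<and>
       ln (norm (h n (w (\<sigma> n)))) \<le> (4 * K) * ln (norm (h n (z (\<sigma> n))))"
  proof eventually_elim
    case (elim n)
    have "ln (norm (h n (w (\<sigma> n)))) \<le> 2 * ln (norm (h n w0))" using elim by blast
    also have "\<dots> \<le> 2 * (K * ln (norm (h n z0)))" using elim by simp
    also have "\<dots> \<le> 2 * (K * (2 * ln (norm (h n (z (\<sigma> n))))))"
      using elim K(1) by (intro mult_left_mono) auto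
    finally show ?case using elim by auto
  qed
  then show thesis using that[of "4 * K" \<sigma>] K(1) \<sigma> by (simp add: h_def)
qed

section \<open>Stretching of curves\<close>

text \<open>The radius \<open>r\<close> is existential because an image under \<open>f\<close>
  replaces it by \<open>M(r, f)\<close>; only its lower bound \<open>R\<close> persists through all
  iterations.\<close>

definition stretched :: "(real \<Rightarrow> real) \<Rightarrow> real \<Rightarrow> real \<Rightarrow> complex set \<Rightarrow> bool" where
  "stretched \<psi> R c S \<longleftrightarrow> connected S \<and>
     (\<exists>r\<ge>R. (\<exists>a\<in>S. norm a \<le> r) \<and> (\<exists>b\<in>S. \<psi> r powr c \<le> norm b))"

text \<open>
  Of the factor \<open>4 m\<^sub>0\<close> in the regularity function, \<open>m\<^sub>0\<close> compensates the width of the annular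
  domain and \<open>2\<close> the loss in \<open>max_modulus_powr_ge\<close>; the remaining \<open>2\<close> doubles \<open>c\<close>.
\<close>

lemma stretched_image:
  assumes f: "transcendental_entire f" and ann: "annular_domain_property m f"
    and m: "1 < m" "m \<le> m0" and reg: "regularity_function f (4 * m0) \<psi>"
  shows "\<exists>R0. \<forall>R\<ge>R0. \<forall>c\<ge>2 * m0. \<forall>S. stretched \<psi> R c S \<longrightarrow> stretched \<psi> R (2 * c) (f ` S)"
proof -
  let ?M = "\<lambda>r. max_modulus r f"
  have holf: "f holomorphic_on UNIV" using f by (simp add: transcendental_entire_def)
  obtain T where T: "\<And>r. r \<ge> T \<Longrightarrow> r \<le> ?M r"
    using transcendental_entire_max_modulus_ge[OF f] by blast
  obtain Ra where Ra: "\<And>r. r \<ge> Ra \<Longrightarrow> \<exists>G. open G \<and> connected G \<and> simply_connected G \<and>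
        ball 0 r \<subseteq> G \<and> G \<subseteq> ball 0 (r powr m) \<and> (\<forall>z\<in>frontier G. norm (f z) \<ge> ?M r)"
    using ann unfolding annular_domain_property_def by blast
  obtain Rr where Rr: "\<And>r. r \<ge> Rr \<Longrightarrow> \<psi> r \<ge> r"
      "\<And>r. r \<ge> Rr \<Longrightarrow> ?M (\<psi> r) \<ge> \<psi> (?M r) powr (4 * m0)"
    using reg unfolding regularity_function_def by blast
  \<comment> \<open>\<open>T\<close> gives \<open>M(r, f) \<ge> r\<close>, \<open>Ra\<close> and
    \<open>Rr\<close> make the annular domains and regularity available, and \<open>2\<close> and
    the square of \<open>M(1, f)\<close> provide the hypotheses of
    \<open>max_modulus_powr_ge\<close> at \<open>\<psi> r\<close>.\<close>
  define R0 where "R0 = Max {2, T, Ra, Rr, (?M 1)\<^sup>2}"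
  have R0: "2 \<le> R0" "T \<le> R0" "Ra \<le> R0" "Rr \<le> R0" "(?M 1)\<^sup>2 \<le> R0"
    unfolding R0_def by (intro Max_ge; simp)+
  show ?thesis
  proof (intro exI[of _ R0] allI impI)
    fix R c S assume R: "R0 \<le> R" and c: "2 * m0 \<le> c" and "stretched \<psi> R c S"
    then obtain r a b where conn: "connected S" and r: "r \<ge> R" and a: "a \<in> S" "norm a \<le> r"
      and b: "b \<in> S" "\<psi> r powr c \<le> norm b"
      unfolding stretched_def by blast
    have rR0: "r \<ge> R0" using r R by simp
    \<comment> \<open>The radius \<open>s\<close> is chosen so that
      \<open>s powr m0 = \<psi> r powr c\<close>: the domain \<open>G\<close> for \<open>s\<close>
      then contains \<open>a\<close>, because \<open>r < s\<close>, but not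
      \<open>b\<close>.\<close>
    define d s where "d = c / m0" and "s = \<psi> r powr d"
    have d: "d \<ge> 2" using c m by (simp add: d_def field_simps)
    have \<psi>r: "\<psi> r \<ge> r" using Rr(1) rR0 R0 by simp
    have "r < r ^ 2" using rR0 R0 by (simp add: power2_eq_square)
    also have "\<dots> \<le> \<psi> r ^ 2" using \<psi>r rR0 R0 by (intro power_mono) auto
    also have "\<dots> = \<psi> r powr 2" using \<psi>r rR0 R0 by simp
    also have "\<dots> \<le> s" unfolding s_def using \<psi>r rR0 R0 d by (intro powr_mono) auto
    finally have rs: "r < s" .
    obtain G where G: "ball 0 s \<subseteq> G" "G \<subseteq> ball 0 (s powr m)" "\<And>z. z \<in> frontier G \<Longrightarrow> norm (f z) \<ge> ?M s"
      using Ra[of s] rs rR0 R0 by auto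
    have "a \<in> G" using a rs G(1) by auto
    moreover have "b \<notin> G"
    proof
      assume "b \<in> G"
      then have "norm b < s powr m" using G(2) by auto
      also have "\<dots> \<le> s powr m0" using rs rR0 R0 m by (intro powr_mono) auto
      also have "\<dots> = \<psi> r powr c" using m by (simp add: s_def powr_powr d_def)
      finally show False using b by simp
    qed
    ultimately obtain z where z: "z \<in> S" "z \<in> frontier G"
      using connected_Int_frontier[OF conn, of G] a b by blast
    have M\<psi>: "\<psi> r \<le> ?M (\<psi> r)" using T \<psi>r rR0 R0 by simp
    \<comment> \<open>The exponents match since \<open>4 * m0 * (d / 2) = 2 * c\<close>. Regularity
      bounds the inner power by \<open>M(\<psi> r, f)\<close>, and the three circles estimate then
      passes from radius \<open>\<psi> r\<close> to \<open>s\<close>.\<close>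
    have "\<psi> (?M r) powr (2 * c) = (\<psi> (?M r) powr (4 * m0)) powr (d / 2)"
      using m by (simp add: powr_powr d_def)
    also have "\<dots> \<le> ?M (\<psi> r) powr (d / 2)"
      using Rr(2)[of r] rR0 R0 d by (intro powr_mono2) auto
    also have "\<dots> \<le> ?M s"
      unfolding s_def by (rule max_modulus_powr_ge[OF holf]) (use M\<psi> \<psi>r rR0 R0 d in auto)
    also have "\<dots> \<le> norm (f z)" by (rule G(3)[OF z(2)])
    finally have "\<psi> (?M r) powr (2 * c) \<le> norm (f z)" .
    moreover have "norm (f a) \<le> ?M r" by (rule max_modulus_upper_cball[OF holf a(2)])
    moreover have "?M r \<ge> R" using T[of r] rR0 R0 r by simp
    moreover have "connected (f ` S)"
      by (intro connected_continuous_image conn holomorphic_on_imp_continuous_on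
            holomorphic_on_subset[OF holf]) auto
    ultimately show "stretched \<psi> R (2 * c) (f ` S)"
      unfolding stretched_def using a z by blast
  qed
qed

text \<open>One threshold \<open>R\<close> and one \<open>\<psi>\<close> serve all maps, and
  doubling keeps the exponent above \<open>c0\<close>, so the steps can be chained.\<close>

lemma stretched_image_foldr:
  assumes step: "\<And>h c S. h \<in> set hs \<Longrightarrow> c \<ge> c0 \<Longrightarrow> stretched \<psi> R c S \<Longrightarrow> stretched \<psi> R (2 * c) (h ` S)"
    and "0 \<le> c0" "c0 \<le> c" "stretched \<psi> R c S"
  shows "stretched \<psi> R (2 ^ length hs * c) (foldr (\<circ>) hs id ` S)"
  using step
proof (induction hs)
  case Nil
  then show ?case using assms(4) by simp
next
  case (Cons h hs)
  have "1 * c \<le> 2 ^ length hs * c" using assms by (intro mult_right_mono) auto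
  then have "stretched \<psi> R (2 * (2 ^ length hs * c)) (h ` (foldr (\<circ>) hs id ` S))"
    using assms by (intro Cons.prems Cons.IH) auto
  moreover have "foldr (\<circ>) (h # hs) id = h \<circ> foldr (\<circ>) hs id" by simp
  ultimately show ?case by (simp only: image_comp length_Cons power_Suc mult.assoc)
qed

lemma stretched_image_funpow:
  assumes step: "\<And>c S. c \<ge> c0 \<Longrightarrow> stretched \<psi> R c S \<Longrightarrow> stretched \<psi> R (2 ^ k * c) (g ` S)"
    and "0 \<le> c0" "stretched \<psi> R c0 S"
  shows "stretched \<psi> R (2 ^ (k * n) * c0) ((g ^^ n) ` S)"
proof (induction n)
  case 0
  then show ?case using assms(3) by simp
next
  case (Suc n)
  have "1 * c0 \<le> 2 ^ (k * n) * c0" using assms by (intro mult_right_mono) auto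
  then have "stretched \<psi> R (2 ^ k * (2 ^ (k * n) * c0)) (g ` ((g ^^ n) ` S))"
    using Suc by (intro step) auto
  then show ?case by (simp add: image_comp mult.assoc[symmetric] power_add)
qed

section \<open>Stretching against Harnack distortion on an unbounded component\<close>

theorem theorem7p1:
  fixes k :: nat and f :: "nat \<Rightarrow> complex \<Rightarrow> complex" and \<psi> :: "real \<Rightarrow> real \<Rightarrow> real"
    and g :: "complex \<Rightarrow> complex"
  assumes "k \<ge> 1"
    and "\<And>j. j \<in> {1..k} \<Longrightarrow> transcendental_entire (f j)"
    and "\<And>j. j \<in> {1..k} \<Longrightarrow> \<exists>m>1. annular_domain_property m (f j)"
    and "\<And>j. j \<in> {1..k} \<Longrightarrow> psi_regular_with (f j) \<psi>"
    and "g = foldr (\<circ>) (map f [1..<Suc k]) id"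
  shows "\<forall>C\<in>components (fatou_set g). bounded C"
proof (rule ballI, rule ccontr)
  fix C assume C: "C \<in> components (fatou_set g)" and unb: "\<not> bounded C"
  obtain m where m: "\<And>j. j \<in> {1..k} \<Longrightarrow> m j > 1 \<and> annular_domain_property (m j) (f j)"
    using assms(3) by metis
  \<comment> \<open>The sum is a convenient common upper bound of the \<open>m j\<close>.\<close>
  define m0 where "m0 = sum m {1..k}"
  have m_le: "m j \<le> m0" if "j \<in> {1..k}" for j
    unfolding m0_def
  proof (rule member_le_sum[OF that])
    show "0 \<le> m i" if "i \<in> {1..k} - {j}" for i using m[of i] that by simp
  qed simp
  have m0: "m0 > 1" using m[of 1] m_le[of 1] assms(1) by auto
  \<comment> \<open>Here the common family matters: one and the same function
    \<open>\<psi> (4 * m0)\<close> works for every factor, so the output of one stretching step is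
    an admissible input for the next.\<close>
  have reg: "regularity_function (f j) (4 * m0) (\<psi> (4 * m0))" if "j \<in> {1..k}" for j
    using assms(4)[OF that] m0 by (simp add: psi_regular_with_def)
  have "\<forall>j\<in>{1..k}. \<exists>R0. \<forall>R\<ge>R0. \<forall>c\<ge>2 * m0. \<forall>S. stretched (\<psi> (4 * m0)) R c S \<longrightarrow>
      stretched (\<psi> (4 * m0)) R (2 * c) (f j ` S)"
  proof
    fix j assume j: "j \<in> {1..k}"
    show "\<exists>R0. \<forall>R\<ge>R0. \<forall>c\<ge>2 * m0. \<forall>S. stretched (\<psi> (4 * m0)) R c S \<longrightarrow>
        stretched (\<psi> (4 * m0)) R (2 * c) (f j ` S)"
      using m[OF j] by (intro stretched_image[of _ "m j"] assms(2) m_le reg j) auto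
  qed
  then obtain R0 where R0: "\<And>j R c S. \<lbrakk>j \<in> {1..k}; R \<ge> R0 j; c \<ge> 2 * m0;
      stretched (\<psi> (4 * m0)) R c S\<rbrakk> \<Longrightarrow> stretched (\<psi> (4 * m0)) R (2 * c) (f j ` S)"
    by metis
  obtain Rr where Rr: "\<And>r. r \<ge> Rr \<Longrightarrow> \<psi> (4 * m0) r \<ge> r"
    using reg[of 1] assms(1) unfolding regularity_function_def by auto
  obtain a where a: "a \<in> C" using in_components_nonempty[OF C] by blast
  \<comment> \<open>Including \<open>norm a\<close> lets \<open>a\<close> be the small point of the
    initial curve at radius \<open>R\<close>; unboundedness of \<open>C\<close> then supplies the
    large point \<open>b\<close>.\<close>
  define R where "R = Max ({2, Rr, norm a} \<union> R0 ` {1..k})"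
  have R: "2 \<le> R" "Rr \<le> R" "norm a \<le> R" "\<And>j. j \<in> {1..k} \<Longrightarrow> R0 j \<le> R"
    unfolding R_def by (intro Max_ge; simp)+
  obtain b where b: "b \<in> C" "\<psi> (4 * m0) R powr (2 * m0) \<le> norm b"
    using unb unfolding bounded_iff by (meson nle_le)
  have "path_connected C"
    using open_components[OF open_fatou_set C] in_components_connected[OF C]
    by (rule connected_open_path_connected)
  then obtain \<gamma> where \<gamma>: "path \<gamma>" "path_image \<gamma> \<subseteq> C" "pathstart \<gamma> = a" "pathfinish \<gamma> = b"
    using a b(1) unfolding path_connected_def by blast
  define S where "S = path_image \<gamma>"
  have "a \<in> S" "b \<in> S" unfolding S_def using \<gamma> pathstart_in_path_image pathfinish_in_path_image by blast+
  then have "stretched (\<psi> (4 * m0)) R (2 * m0) S"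
    unfolding stretched_def using R b \<gamma>(1) by (auto simp: S_def connected_path_image)
  moreover have "stretched (\<psi> (4 * m0)) R (2 ^ k * c) (g ` S)"
    if "c \<ge> 2 * m0" "stretched (\<psi> (4 * m0)) R c S" for c S
  proof -
    have "stretched (\<psi> (4 * m0)) R (2 ^ length (map f [1..<Suc k]) * c)
        (foldr (\<circ>) (map f [1..<Suc k]) id ` S)"
    proof (rule stretched_image_foldr[OF _ _ that])
      fix h c S assume "h \<in> set (map f [1..<Suc k])"
        and c: "2 * m0 \<le> c" "stretched (\<psi> (4 * m0)) R c S"
      then obtain j where j: "j \<in> {1..k}" "h = f j" by (auto simp: atLeastLessThanSuc_atLeastAtMost simp del: upt_Suc)
      show "stretched (\<psi> (4 * m0)) R (2 * c) (h ` S)"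
        unfolding j(2) by (rule R0[OF j(1) R(4)[OF j(1)] c])
    qed (use m0 in simp)
    then show ?thesis unfolding assms(5) by (simp del: upt_Suc)
  qed
  ultimately have st: "stretched (\<psi> (4 * m0)) R (2 ^ (k * n) * (2 * m0)) ((g ^^ n) ` S)" for n
    using m0 by (intro stretched_image_funpow) auto
  \<comment> \<open>The function \<open>\<psi>\<close> is eliminated by
    \<open>\<psi> r \<ge> r\<close>, and the exponent is weakened to \<open>2 ^ n\<close> by
    \<open>k \<ge> 1\<close> and \<open>m0 > 1\<close>.\<close>
  have "\<exists>z w r. z \<in> S \<and> w \<in> S \<and> r \<ge> 2 \<and> norm ((g ^^ n) z) \<le> r \<and> r powr 2 ^ n \<le> norm ((g ^^ n) w)" for n
  proof -
    obtain z w r where zw: "z \<in> S" "w \<in> S" "r \<ge> R" "norm ((g ^^ n) z) \<le> r"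
      and w: "\<psi> (4 * m0) r powr (2 ^ (k * n) * (2 * m0)) \<le> norm ((g ^^ n) w)"
      using st[of n] unfolding stretched_def by blast
    have "(2::real) ^ n * 1 \<le> 2 ^ (k * n) * (2 * m0)"
      using assms(1) m0 by (intro mult_mono power_increasing) auto
    then have "r powr 2 ^ n \<le> r powr (2 ^ (k * n) * (2 * m0))"
      using zw R by (intro powr_mono) auto
    also have "\<dots> \<le> \<psi> (4 * m0) r powr (2 ^ (k * n) * (2 * m0))"
      using Rr[of r] zw R m0 by (intro powr_mono2) auto
    finally show ?thesis using zw w R by (intro exI[of _ z] exI[of _ w] exI[of _ r]) auto
  qed
  then obtain z w r where zw: "\<And>n. z n \<in> S" "\<And>n. w n \<in> S" and r: "\<And>n. r n \<ge> 2"
    and z: "\<And>n. norm ((g ^^ n) (z n)) \<le> r n" and w: "\<And>n. r n powr 2 ^ n \<le> norm ((g ^^ n) (w n))"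
    by metis
  have w_ge: "real n \<le> norm ((g ^^ n) (w n))" for n
  proof -
    have "real n \<le> 2 ^ n" using of_nat_less_two_power[of n] by (simp add: less_imp_le)
    also have "\<dots> \<le> r n powr 2 ^ n"
    proof -
      have "(2::real) ^ n \<le> 2 powr 2 ^ n"
        using of_nat_less_two_power[of n, where 'a=real]
        by (simp add: powr_realpow[symmetric])
      also have "\<dots> \<le> r n powr 2 ^ n" using r by (intro powr_mono2) auto
      finally show ?thesis .
    qed
    finally show ?thesis using w[of n] by simp
  qed
  have esc: "filterlim (\<lambda>n. norm ((g ^^ n) (w n))) at_top sequentially"
    by (rule filterlim_at_top_mono[OF filterlim_real_sequentially]) (use w_ge in auto)
  have holg: "g holomorphic_on UNIV"
  proof -
    have "foldr (\<circ>) hs id holomorphic_on UNIV" if "\<And>h. h \<in> set hs \<Longrightarrow> h holomorphic_on UNIV"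
      for hs :: "(complex \<Rightarrow> complex) list"
      using that by (induction hs) (auto simp: id_def intro: holomorphic_on_compose_gen)
    moreover have "h holomorphic_on UNIV" if "h \<in> set (map f [1..<Suc k])" for h
      using that assms(2)
      by (auto simp: transcendental_entire_def atLeastLessThanSuc_atLeastAtMost simp del: upt_Suc)
    ultimately show ?thesis
      unfolding assms(5) by blast
  qed
  have S: "compact S" "S \<subseteq> C" using \<gamma> by (auto simp: S_def compact_path_image)
  obtain K \<sigma> where K: "K > 0" and \<sigma>: "strict_mono (\<sigma> :: nat \<Rightarrow> nat)"
    and ev: "\<forall>\<^sub>F n in sequentially. 1 < norm ((g ^^ \<sigma> n) (z (\<sigma> n))) \<and>
       ln (norm ((g ^^ \<sigma> n) (w (\<sigma> n)))) \<le> K * ln (norm ((g ^^ \<sigma> n) (z (\<sigma> n))))"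
    by (rule fatou_component_distortion[OF C holg S zw esc])
  obtain N where N: "K < real N" using reals_Archimedean2 by blast
  \<comment> \<open>Comparing logarithms at \<open>z\<close> and \<open>w\<close> cancels
    \<open>ln (r (\<sigma> n))\<close> and leaves \<open>2 ^ \<sigma> n \<le> K\<close>, which fails
    once \<open>\<sigma> n \<ge> N > K\<close>.\<close>
  have "\<forall>\<^sub>F n::nat in sequentially. False"
    using ev eventually_ge_at_top[of N]
  proof eventually_elim
    case (elim n)
    let ?k = "\<sigma> n"
    have rk: "ln (r ?k) > 0" using r[of ?k] by simp
    have "2 ^ ?k * ln (r ?k) = ln (r ?k powr 2 ^ ?k)" using r[of ?k] by (simp add: ln_powr)
    also have "\<dots> \<le> ln (norm ((g ^^ ?k) (w ?k)))"
      using w[of ?k] r[of ?k] by (intro ln_mono) auto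
    also have "\<dots> \<le> K * ln (norm ((g ^^ ?k) (z ?k)))" using elim by blast
    also have "\<dots> \<le> K * ln (r ?k)"
      using K z[of ?k] elim by (intro mult_left_mono ln_mono) auto
    finally have "2 ^ ?k \<le> K" using rk by simp
    moreover have "real N \<le> real ?k" using elim strict_mono_imp_increasing[OF \<sigma>, of n] by simp
    ultimately show False using N of_nat_less_two_power[of ?k, where 'a=real] by linarith
  qed
  then show False by simp
qed

end
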